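(* For every convex body $K\in\mathbb{K}^n$ one has $\mathcal{P}(K)=\mathcal{F}(K)$. That is, the set of values at $K$ of all affine-invariant points equals the set of all points of $\mathbb{R}^n$ that are fixed by every affine map of $K$ onto itself.
   Context: $\mathbb{K}^n$ is the set of all convex bodies (compact convex sets with nonempty interior) in $\mathbb{R}^n$, equipped with the Hausdorff metric $d_H(K_1,K_2)=\min\{\lambda\ge 0: K_1\subset K_2+\lambda B_2^n,\ K_2\subset K_1+\lambda B_2^n\}$, where $B_2^n$ is the Euclidean unit ball. An affine-invariant point is a function $P:\mathbb{K}^n\to\mathbb{R}^n$ such that (1) for every nonsingular affine map $\varphi:\mathbb{R}^n\to\mathbb{R}^n$ and every $K\in\mathbb{K}^n$, $P(\varphi(K))=\varphi(P(K))$; and (2) $P$ is continuous with respect to the Hausdorff metric. $\mathcal{P}$ is the set of all affine-invariant points in $\mathbb{R}^n$, and $\mathcal{P}(K)=\{P(K): P\in\mathcal{P}\}$. $\mathcal{F}(K)$ is the set of points $x\in\mathbb{R}^n$ such that $\varphi(x)=x$ for every affine map $\varphi$ of $\mathbb{R}^n$ with $\varphi(K)=K$. *)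

theory Defs
  imports "HOL-Analysis.Analysis" "HOL-Library.Set_Algebras"
begin

definition convex_body :: "(real ^ 'n) set \<Rightarrow> bool" where
  "convex_body K \<longleftrightarrow> compact K \<and> convex K \<and> interior K \<noteq> {}"

(* The sums of sets are Minkowski sums (HOL-Library.Set_Algebras). The infimum is a minimum
   on nonempty compact sets, see hausdorff_dist_is_min below. *)
definition hausdorff_dist :: "(real ^ 'n) set \<Rightarrow> (real ^ 'n) set \<Rightarrow> real" where
  "hausdorff_dist K L = Inf {r. 0 \<le> r \<and> K \<subseteq> L + (\<lambda>x. r *\<^sub>R x) ` cball 0 1
                                    \<and> L \<subseteq> K + (\<lambda>x. r *\<^sub>R x) ` cball 0 1}"

definition affine_map :: "(real ^ 'n \<Rightarrow> real ^ 'n) \<Rightarrow> bool" where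
  "affine_map \<phi> \<longleftrightarrow> (\<exists>A b. \<forall>x. \<phi> x = A *v x + b)"

definition nonsingular_affine_map :: "(real ^ 'n \<Rightarrow> real ^ 'n) \<Rightarrow> bool" where
  "nonsingular_affine_map \<phi> \<longleftrightarrow> (\<exists>A b. invertible A \<and> (\<forall>x. \<phi> x = A *v x + b))"

definition hausdorff_continuous :: "((real ^ 'n) set \<Rightarrow> real ^ 'n) \<Rightarrow> bool" where
  "hausdorff_continuous P \<longleftrightarrow>
     (\<forall>K. convex_body K \<longrightarrow> (\<forall>\<epsilon>>0. \<exists>\<delta>>0. \<forall>L. convex_body L \<longrightarrow>
        hausdorff_dist L K < \<delta> \<longrightarrow> dist (P L) (P K) < \<epsilon>))"

(* P is a total function on sets, but only its values on convex bodies are constrained or used. *)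
definition affine_invariant_point :: "((real ^ 'n) set \<Rightarrow> real ^ 'n) \<Rightarrow> bool" where
  "affine_invariant_point P \<longleftrightarrow>
     (\<forall>\<phi> K. nonsingular_affine_map \<phi> \<longrightarrow> convex_body K \<longrightarrow> P (\<phi> ` K) = \<phi> (P K)) \<and>
     hausdorff_continuous P"

definition affine_invariant_values :: "(real ^ 'n) set \<Rightarrow> (real ^ 'n) set" where
  "affine_invariant_values K = {P K | P. affine_invariant_point P}"

definition affine_fixed_points :: "(real ^ 'n) set \<Rightarrow> (real ^ 'n) set" where
  "affine_fixed_points K = {x. \<forall>\<phi>. affine_map \<phi> \<longrightarrow> \<phi> ` K = K \<longrightarrow> \<phi> x = x}"

lemma subset_parallel_body_iff:
  fixes K L :: "(real ^ 'n) set"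
  assumes "compact L" "L \<noteq> {}" "0 \<le> r"
  shows "K \<subseteq> L + (\<lambda>x. r *\<^sub>R x) ` cball 0 1 \<longleftrightarrow> (\<forall>x\<in>K. infdist x L \<le> r)"
proof -
  have cb: "(\<lambda>x. r *\<^sub>R x) ` cball 0 1 = cball (0 :: real ^ 'n) r"
    using cball_scale[of r "0 :: real ^ 'n" 1] assms(3)
    by (cases "r = 0") (auto simp: image_constant_conv)
  have "x \<in> L + cball 0 r \<longleftrightarrow> infdist x L \<le> r" for x
  proof
    assume "x \<in> L + cball 0 r"
    then obtain y z where yz: "y \<in> L" "z \<in> cball 0 r" "x = y + z"
      by (auto elim: set_plus_elim)
    have "infdist x L \<le> dist x y" using yz(1) by (rule infdist_le)
    also have "dist x y \<le> r" using yz by (simp add: dist_norm)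
    finally show "infdist x L \<le> r" .
  next
    assume le: "infdist x L \<le> r"
    obtain y where y: "y \<in> L" "infdist x L = dist x y"
      using infdist_attains_inf[OF compact_imp_closed[OF assms(1)] assms(2)] by metis
    have "x - y \<in> cball 0 r" using le y by (simp add: dist_norm norm_minus_commute)
    then have "y + (x - y) \<in> L + cball 0 r" using y(1) by (rule set_plus_intro[rotated])
    then show "x \<in> L + cball 0 r" by simp
  qed
  then show ?thesis unfolding cb by blast
qed

lemma hausdorff_dist_is_min:
  fixes K L :: "(real ^ 'n) set"
  assumes "compact K" "K \<noteq> {}" "compact L" "L \<noteq> {}"
  defines "S \<equiv> {r. 0 \<le> r \<and> K \<subseteq> L + (\<lambda>x. r *\<^sub>R x) ` cball 0 1
                         \<and> L \<subseteq> K + (\<lambda>x. r *\<^sub>R x) ` cball 0 1}"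
  shows "hausdorff_dist K L \<in> S \<and> (\<forall>r\<in>S. hausdorff_dist K L \<le> r)"
proof -
  have S: "S = {0..} \<inter> (\<Inter>x\<in>K. {infdist x L..}) \<inter> (\<Inter>x\<in>L. {infdist x K..})"
  proof (rule set_eqI)
    fix r
    show "r \<in> S \<longleftrightarrow> r \<in> {0..} \<inter> (\<Inter>x\<in>K. {infdist x L..}) \<inter> (\<Inter>x\<in>L. {infdist x K..})"
      using subset_parallel_body_iff[OF assms(3,4), of r K]
        subset_parallel_body_iff[OF assms(1,2), of r L]
      by (cases "0 \<le> r") (auto simp: S_def)
  qed
  have cl: "closed S" unfolding S by (intro closed_Int closed_INT ballI closed_atLeast)
  have bd: "bdd_below S" unfolding S_def by (intro bdd_belowI[of _ 0]) auto
  obtain B where B: "dist x y \<le> B" if "x \<in> K \<union> L" "y \<in> K \<union> L" for x y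
    using diameter_bounded_bound[of "K \<union> L"] assms(1,3)
    by (metis bounded_Un compact_imp_bounded)
  obtain k l where kl: "k \<in> K" "l \<in> L" using assms by blast
  have "0 \<le> B" using kl order_trans[OF zero_le_dist B[of k l]] by blast
  moreover have "infdist x L \<le> B" if "x \<in> K" for x
    using infdist_le2[OF kl(2)] B that kl(2) by blast
  moreover have "infdist x K \<le> B" if "x \<in> L" for x
    using infdist_le2[OF kl(1)] B that kl(1) by blast
  ultimately have "B \<in> S" unfolding S by simp
  then show ?thesis
    using closed_contains_Inf[OF _ bd cl] cInf_lower[OF _ bd]
    unfolding hausdorff_dist_def S_def[symmetric] by auto
qed

end

(* Fix K and a point x fixed by all affine automorphisms of K. For a body L, the affine maps v with
   v(K) contained in L form a compact convex set C(K, L) with nonempty interior in the vector space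
   of all affine maps, and C(K, phi(L)) = phi C(K, L) for nonsingular phi. The mean of v(x) over C(K, L)
   with respect to Lebesgue measure weighted by |det v|^m is therefore equivariant in L, because
   composition with phi multiplies the weighted measure by a constant, and it is continuous in L
   because the frontier of a convex set is negligible. On C(K, K) one has |det v| <= 1, with equality
   only for automorphisms of K, which fix x; so the mean for L = K tends to x as m grows. Finally, the
   values at K of affine-invariant points form an affine subspace, which is closed, hence contains x. *)

theory Submission
  imports Defs
begin

subsection \<open>Lebesgue measure under affine bijections\<close>

lemma nn_integral_lborel_shift:
  fixes f :: "'a::euclidean_space \<Rightarrow> ennreal"
  assumes [measurable]: "f \<in> borel_measurable borel"
  shows "(\<integral>\<^sup>+x. f (x + c) \<partial>lborel) = (\<integral>\<^sup>+x. f x \<partial>lborel)"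
proof -
  have "(\<integral>\<^sup>+x. f x \<partial>lborel) = (\<integral>\<^sup>+x. f x \<partial>distr lborel borel ((+) c))"
    by (simp add: lborel_distr_plus)
  also have "\<dots> = (\<integral>\<^sup>+x. f (c + x) \<partial>lborel)"
    by (intro nn_integral_distr) auto
  finally show ?thesis by (simp add: add.commute)
qed

text \<open>The hypothesis makes the image of Lebesgue measure under \<open>T\<close> translation invariant; Fubini then gives uniqueness up to a factor. The library's change of variables
  formulas are not applicable to the space of affine maps, as they need a well-ordered index type.\<close>

lemma emeasure_vimage_equivariant_swap:
  fixes T :: "'a::euclidean_space \<Rightarrow> 'a"
  assumes T[measurable]: "T \<in> borel_measurable borel"
    and eq: "\<And>x y. T (x + S y) = T x + y"
    and [measurable]: "A \<in> sets borel" "B \<in> sets borel"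
  shows "emeasure lborel (T -` A) * emeasure lborel B
    = emeasure lborel (T -` B) * emeasure lborel (uminus -` A)"
proof -
  have vT: "T -` X \<in> sets borel" if "X \<in> sets borel" for X
    using measurable_sets[OF T that] by simp
  have em: "emeasure lborel (T -` X) = (\<integral>\<^sup>+x. indicator X (T x) \<partial>lborel)" if "X \<in> sets borel" for X
    using vT[OF that] by (simp flip: nn_integral_indicator add: indicator_def vimage_def)
  have [measurable]: "uminus -` A \<in> sets borel"
    using measurable_sets[of uminus borel borel A] by simp
  have um: "emeasure lborel (uminus -` A) = (\<integral>\<^sup>+y. indicator A (- y) \<partial>lborel)"
    by (simp flip: nn_integral_indicator add: indicator_def vimage_def)
  have "emeasure lborel (T -` A) * emeasure lborel B
      = (\<integral>\<^sup>+x. indicator A (T x) * (\<integral>\<^sup>+y. indicator B y \<partial>lborel) \<partial>lborel)"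
    by (simp add: em nn_integral_multc)
  \<comment> \<open>The inner variable is translated by \<open>T x\<close>, which leaves the inner
    integral unchanged but couples \<open>A\<close> and \<open>B\<close> in one double
    integral.\<close>
  also have "\<dots> = (\<integral>\<^sup>+x. \<integral>\<^sup>+y. indicator A (T x) * indicator B (y + T x) \<partial>lborel \<partial>lborel)"
  proof (rule nn_integral_cong)
    fix x
    show "indicator A (T x) * (\<integral>\<^sup>+y. indicator B y \<partial>lborel)
        = (\<integral>\<^sup>+y. indicator A (T x) * indicator B (y + T x) \<partial>lborel)"
      by (subst nn_integral_lborel_shift[symmetric, of "indicator B" "T x"])
        (simp_all add: nn_integral_cmult)
  qed
  also have "\<dots> = (\<integral>\<^sup>+y. \<integral>\<^sup>+x. indicator A (T x) * indicator B (y + T x) \<partial>lborel \<partial>lborel)"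
    by (subst lborel_pair.Fubini') simp_all
  \<comment> \<open>Translating \<open>x\<close> by \<open>S y\<close> adds \<open>y\<close> to
    \<open>T x\<close>, by \<open>eq\<close>; the offset thus moves from \<open>B\<close> to
    \<open>A\<close>.\<close>
  also have "\<dots> = (\<integral>\<^sup>+y. \<integral>\<^sup>+x. indicator A (T x - y) * indicator B (T x) \<partial>lborel \<partial>lborel)"
  proof (rule nn_integral_cong)
    fix y
    show "(\<integral>\<^sup>+x. indicator A (T x) * indicator B (y + T x) \<partial>lborel)
        = (\<integral>\<^sup>+x. indicator A (T x - y) * indicator B (T x) \<partial>lborel)"
      using nn_integral_lborel_shift[of "\<lambda>x. indicator A (T x - y) * indicator B (T x)" "S y"]
      by (simp add: eq add.commute)
  qed
  also have "\<dots> = (\<integral>\<^sup>+x. \<integral>\<^sup>+y. indicator A (T x - y) * indicator B (T x) \<partial>lborel \<partial>lborel)"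
    by (subst lborel_pair.Fubini') simp_all
  also have "\<dots> = (\<integral>\<^sup>+x. emeasure lborel (uminus -` A) * indicator B (T x) \<partial>lborel)"
  proof (rule nn_integral_cong)
    fix x
    have "(\<integral>\<^sup>+y. indicator A (T x - y) \<partial>lborel) = (emeasure lborel (uminus -` A) :: ennreal)"
      using nn_integral_lborel_shift[of "\<lambda>y. indicator A (T x - y)" "T x"] by (simp add: um)
    then show "(\<integral>\<^sup>+y. indicator A (T x - y) * indicator B (T x) \<partial>lborel)
        = emeasure lborel (uminus -` A) * indicator B (T x)"
      by (simp add: nn_integral_multc)
  qed
  also have "\<dots> = emeasure lborel (T -` B) * emeasure lborel (uminus -` A)"
    using nn_integral_cmult[of "\<lambda>x. indicator B (T x)" lborel "emeasure lborel (uminus -` A)"]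
    by (simp add: em[of B] mult.commute[of "emeasure lborel (uminus -` A)"])
  finally show ?thesis .
qed

text \<open>Take the unit box, of measure 1, as \<open>B\<close> in the exchange formula. The
  reflection of \<open>A\<close> disappears by the same formula for the identity map.\<close>

lemma emeasure_vimage_equivariant:
  fixes T :: "'a::euclidean_space \<Rightarrow> 'a"
  assumes T: "T \<in> borel_measurable borel"
    and eq: "\<And>x y. T (x + S y) = T x + y"
    and A: "A \<in> sets borel"
  shows "emeasure lborel (T -` A) = emeasure lborel (T -` box 0 One) * emeasure lborel A"
proof -
  have 1: "emeasure lborel (box 0 One :: 'a set) = 1"
    by (subst emeasure_lborel_box) auto
  have "emeasure lborel (uminus -` A) = emeasure lborel A"
    using emeasure_vimage_equivariant_swap[of "\<lambda>x. x" "\<lambda>x. x" A "box 0 One"] A 1 by simp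
  then show ?thesis
    using emeasure_vimage_equivariant_swap[OF T eq A, of "box 0 One"] 1 by simp
qed

text \<open>The factor of proportionality is positive and finite as soon as some nonempty open set
  has a ball as its preimage under \<open>T\<close>. The continuous left inverse \<open>T'\<close>
  supplies such a set.\<close>

lemma distr_lborel_equivariant:
  fixes T T' :: "'a::euclidean_space \<Rightarrow> 'a"
  assumes T: "T \<in> borel_measurable borel"
    and eq: "\<And>x y. T (x + S y) = T x + y"
    and T': "continuous_on UNIV T'" "\<And>x. T' (T x) = x"
  obtains k :: real where "k > 0"
    "distr lborel borel T = density lborel (\<lambda>_. ennreal k)"
proof -
  define c where "c = emeasure lborel (T -` box 0 One)"
  have c: "emeasure lborel (T -` A) = c * emeasure lborel A" if "A \<in> sets borel" for A
    using emeasure_vimage_equivariant[OF T eq that] unfolding c_def .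
  define U where "U = T' -` ball 0 1"
  have U: "open U" unfolding U_def using T'(1) by (intro open_vimage) auto
  have "T 0 \<in> U" by (simp add: U_def T'(2))
  then have pos: "emeasure lborel U \<noteq> 0"
    using U open_not_negligible[of U]
    by (auto simp: negligible_iff_null_sets null_sets_def)
  have "T -` U = ball 0 1" by (auto simp: U_def T'(2))
  then have cU: "c * emeasure lborel U = emeasure lborel (ball (0::'a) 1)"
    using c[of U] U by simp
  have "emeasure lborel (ball (0::'a) 1) < \<infinity>"
    by (intro emeasure_bounded_finite) auto
  moreover have "emeasure lborel (ball (0::'a) 1) \<noteq> 0"
    using open_not_negligible[of "ball (0::'a) 1"]
    by (auto simp: negligible_iff_null_sets null_sets_def)
  ultimately have "c \<noteq> \<infinity>" "c \<noteq> 0" using cU pos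
    by (auto simp: ennreal_top_mult)
  then obtain k where k: "c = ennreal k" "k > 0"
    by (cases c) (auto simp: ennreal_eq_0_iff)
  have d: "distr lborel borel T = density lborel (\<lambda>_. ennreal k)"
    by (rule measure_eqI) (use T in \<open>simp_all add: emeasure_distr emeasure_density c nn_integral_cmult flip: k(1)\<close>)
  show ?thesis using that[OF k(2) d] .
qed

lemma integral_scaled_distr:
  fixes f :: "'a::euclidean_space \<Rightarrow> 'b::euclidean_space"
  assumes "T \<in> borel_measurable borel" "distr lborel borel T = density lborel (\<lambda>_. ennreal k)" "k > 0"
    and "f \<in> borel_measurable borel"
  shows "(\<integral>x. f (T x) \<partial>lborel) = k *\<^sub>R (\<integral>x. f x \<partial>lborel)"
proof -
  have "(\<integral>x. f (T x) \<partial>lborel) = integral\<^sup>L (distr lborel borel T) f"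
    using assms by (intro integral_distr[symmetric]) auto
  also have "\<dots> = (\<integral>x. k *\<^sub>R f x \<partial>lborel)"
    unfolding assms(2) using assms by (intro integral_density) auto
  finally show ?thesis by simp
qed

subsection \<open>Affine maps sending one set into another\<close>

text \<open>A pair of a matrix and a vector encodes an affine map. In this form the affine maps,
  singular ones included, make up a Euclidean space and carry \<open>lborel\<close>.\<close>

definition aff_app :: "(real^'n^'n) \<times> (real^'n) \<Rightarrow> real^'n \<Rightarrow> real^'n" where
  "aff_app v x = fst v *v x + snd v"

definition aff_comp :: "(real^'n^'n) \<times> (real^'n) \<Rightarrow> (real^'n^'n) \<times> (real^'n) \<Rightarrow> (real^'n^'n) \<times> (real^'n)" where
  "aff_comp v w = (fst v ** fst w, fst v *v snd w + snd v)"

text \<open>The factor by which the affine map scales volume.\<close>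

definition abs_det :: "(real^'n^'n) \<times> (real^'n) \<Rightarrow> real" where
  "abs_det v = \<bar>det (fst v)\<bar>"

text \<open>The domain of integration: convex for convex \<open>L\<close>, and compact for compact
  \<open>L\<close> when \<open>K\<close> has nonempty interior.\<close>

definition placements :: "(real^'n) set \<Rightarrow> (real^'n) set \<Rightarrow> ((real^'n^'n) \<times> (real^'n)) set" where
  "placements K L = {v. aff_app v ` K \<subseteq> L}"

lemma aff_app_comp: "aff_app (aff_comp v w) x = aff_app v (aff_app w x)"
  by (simp add: aff_app_def aff_comp_def matrix_vector_mul_assoc matrix_vector_right_distrib)

lemma abs_det_comp: "abs_det (aff_comp v w) = abs_det v * abs_det w"
  by (simp add: abs_det_def aff_comp_def det_mul abs_mult)

lemma abs_det_nonneg [simp]: "0 \<le> abs_det v"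
  by (simp add: abs_det_def)

lemma bounded_bilinear_matrix_vector_mult:
  "bounded_bilinear ((*v) :: real^'n^'m \<Rightarrow> real^'n \<Rightarrow> real^'m)"
  by (subst bilinear_conv_bounded_bilinear[symmetric])
    (auto simp: bilinear_def matrix_vector_mult_add_rdistrib matrix_vector_right_distrib
      matrix_vector_mult_scaleR scaleR_matrix_vector_assoc[symmetric] intro!: linearI)

lemma continuous_on_aff_app [continuous_intros]:
  assumes "continuous_on S f" "continuous_on S g"
  shows "continuous_on S (\<lambda>z. aff_app (f z) (g z))"
  unfolding aff_app_def
  by (intro continuous_intros bounded_bilinear.continuous_on[OF bounded_bilinear_matrix_vector_mult] assms)

lemma continuous_on_abs_det [continuous_intros]:
  assumes "continuous_on S f"
  shows "continuous_on S (\<lambda>z. abs_det (f z))"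
  unfolding abs_det_def det_def by (intro continuous_intros assms)

lemma continuous_on_aff_comp:
  "continuous_on UNIV (aff_comp v)"
proof -
  have "linear (\<lambda>w. (fst v ** fst w, fst v *v snd w))"
    by (intro linearI) (auto simp: matrix_add_ldistrib matrix_vector_right_distrib matrix_scalar_ac
      scalar_matrix_assoc[symmetric] matrix_vector_mult_scaleR)
  then have "continuous_on UNIV (\<lambda>w. (fst v ** fst w, fst v *v snd w) + (0, snd v))"
    by (intro continuous_intros linear_continuous_on) (simp add: linear_conv_bounded_linear)
  then show ?thesis unfolding aff_comp_def by simp
qed

lemma placements_iff: "v \<in> placements K L \<longleftrightarrow> (\<forall>x\<in>K. aff_app v x \<in> L)"
  by (auto simp: placements_def)

lemma closed_placements:
  assumes "closed L"
  shows "closed (placements K L)"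
proof -
  have "placements K L = (\<Inter>x\<in>K. (\<lambda>v. aff_app v x) -` L)"
    by (auto simp: placements_iff)
  then show ?thesis
    using assms by (auto intro!: closed_INT closed_vimage continuous_intros)
qed

lemma convex_placements:
  fixes L :: "(real^'n) set"
  assumes "convex L"
  shows "convex (placements K L)"
proof (rule convexI)
  fix v w :: "(real^'n^'n) \<times> (real^'n)" and s t :: real
  assume vw: "v \<in> placements K L" "w \<in> placements K L" and st: "0 \<le> s" "0 \<le> t" "s + t = 1"
  have "aff_app (s *\<^sub>R v + t *\<^sub>R w) x = s *\<^sub>R aff_app v x + t *\<^sub>R aff_app w x" for x
    by (simp add: aff_app_def matrix_vector_mult_add_rdistrib scaleR_matrix_vector_assoc[symmetric] algebra_simps)
  then show "s *\<^sub>R v + t *\<^sub>R w \<in> placements K L"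
    using vw st convexD[OF assms] by (auto simp: placements_iff)
qed

text \<open>The compact image of \<open>K\<close> keeps a positive distance from the complement of
  \<open>U\<close>, and \<open>aff_app v x\<close> is Lipschitz in \<open>v\<close> uniformly over
  the bounded set \<open>K\<close>.\<close>

lemma open_placements:
  fixes K U :: "(real^'n) set"
  assumes "compact K" "open U"
  shows "open (placements K U)"
proof (cases "K = {}")
  case False
  show ?thesis
    unfolding open_dist
  proof
    fix v assume v: "v \<in> placements K U"
    obtain e where e: "e > 0" "{x. infdist x (aff_app v ` K) \<le> e} \<subseteq> U"
      using False assms v
      by (rule_tac compact_in_open_separated[of "aff_app v ` K" U])
        (auto intro!: compact_continuous_image continuous_intros simp: placements_def)
    obtain B where B: "B > 0" "\<And>(A::real^'n^'n) x. norm (A *v x) \<le> norm A * norm x * B"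
      using bounded_bilinear.pos_bounded[OF bounded_bilinear_matrix_vector_mult] by metis
    obtain N where N: "N > 0" "\<And>x. x \<in> K \<Longrightarrow> norm x \<le> N"
      using compact_imp_bounded[OF assms(1)] by (meson bounded_pos)
    \<comment> \<open>\<open>N * B + 1\<close> is the uniform Lipschitz constant:
      \<open>N * B\<close> for the matrix part and 1 for the translation part.\<close>
    have "w \<in> placements K U" if w: "dist w v < e / (N * B + 1)" for w
      unfolding placements_iff
    proof
      fix x assume x: "x \<in> K"
      have f: "norm (fst w - fst v) \<le> dist w v" and s: "norm (snd w - snd v) \<le> dist w v"
        using dist_fst_le[of w v] dist_snd_le[of w v] by (simp_all add: dist_norm)
      have "aff_app w x - aff_app v x = (fst w - fst v) *v x + (snd w - snd v)"
        by (simp add: aff_app_def algebra_simps)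
      also have "norm \<dots> \<le> norm (fst w - fst v) * norm x * B + norm (snd w - snd v)"
        by (intro order_trans[OF norm_triangle_ineq] add_right_mono B(2))
      also have "\<dots> \<le> dist w v * N * B + dist w v"
        using f s N(2)[OF x] B(1) by (intro add_mono mult_right_mono mult_mono) auto
      also have "\<dots> = dist w v * (N * B + 1)" by (simp add: algebra_simps)
      also have "\<dots> \<le> e" using w N(1) B(1)
        by (simp add: pos_less_divide_eq add_pos_pos less_imp_le)
      finally have "dist (aff_app w x) (aff_app v x) \<le> e" by (simp add: dist_norm)
      then have "infdist (aff_app w x) (aff_app v ` K) \<le> e"
        using x by (intro infdist_le2[of "aff_app v x"]) auto
      then show "aff_app w x \<in> U" using e(2) by auto
    qed
    moreover have "e / (N * B + 1) > 0" using e N B by (simp add: add_pos_pos)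
    ultimately show "\<exists>e>0. \<forall>w. dist w v < e \<longrightarrow> w \<in> placements K U" by blast
  qed
qed (auto simp: placements_def)

text \<open>One inclusion is openness of \<open>placements K (interior L)\<close>. For the other,
  changing only the translation part of \<open>v\<close> already moves \<open>aff_app v x\<close>
  over a whole ball.\<close>

lemma interior_placements:
  fixes K L :: "(real^'n) set"
  assumes K: "compact K"
  shows "interior (placements K L) = placements K (interior L)"
proof
  show "placements K (interior L) \<subseteq> interior (placements K L)"
    using open_placements[OF K open_interior] interior_subset[of L]
    by (intro interior_maximal) (auto simp: placements_def)
  show "interior (placements K L) \<subseteq> placements K (interior L)"
  proof
    fix v assume "v \<in> interior (placements K L)"
    then obtain e where e: "e > 0" "ball v e \<subseteq> placements K L"
      by (meson mem_interior)
    have "aff_app v x \<in> interior L" if x: "x \<in> K" for x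
      unfolding mem_interior
    proof (intro exI conjI subsetI)
      fix y assume "y \<in> ball (aff_app v x) e"
      then have "v + (0, y - aff_app v x) \<in> ball v e"
        by (simp add: dist_norm norm_minus_commute norm_Pair)
      then have "aff_app (v + (0, y - aff_app v x)) x \<in> L"
        using e x by (auto simp: placements_iff)
      then show "y \<in> L" by (simp add: aff_app_def algebra_simps)
    qed (rule e)
    then show "v \<in> placements K (interior L)" by (simp add: placements_iff)
  qed
qed

text \<open>An affine map is controlled by its values on a ball in \<open>K\<close>: differences of
  values bound the columns of the matrix, and then the value at the centre bounds the translation
  part.\<close>

lemma bounded_placements:
  fixes K L :: "(real^'n) set"
  assumes K: "interior K \<noteq> {}" and L: "bounded L"
  shows "bounded (placements K L)"
proof -
  obtain p r where r: "r > 0" "ball p r \<subseteq> K"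
    using K mem_interior by blast
  obtain R where R: "R > 0" "\<And>x. x \<in> L \<Longrightarrow> norm x \<le> R"
    using L by (meson bounded_pos)
  obtain B where B: "B > 0" "\<And>(A::real^'n^'n) x. norm (A *v x) \<le> norm A * norm x * B"
    using bounded_bilinear.pos_bounded[OF bounded_bilinear_matrix_vector_mult] by metis
  \<comment> \<open>Each matrix entry is at most \<open>4 * R / r\<close>: two points of
    \<open>L\<close> differ by at most \<open>2 * R\<close>, and their preimages are
    \<open>r / 2\<close> apart along an axis.\<close>
  define M where "M = (\<Sum>i\<in>(UNIV::'n set). \<Sum>j\<in>(UNIV::'n set). 4 * R / r)"
  have "norm v \<le> M + (R + M * norm p * B)" if v: "v \<in> placements K L" for v
  proof -
    have inK: "aff_app v x \<in> L" if "x \<in> K" for x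
      using v that by (auto simp: placements_iff)
    have p: "p \<in> K" using r by auto
    have ij: "\<bar>fst v $ i $ j\<bar> \<le> 4 * R / r" for i j
    proof -
      have "p + (r/2) *\<^sub>R axis j 1 \<in> K"
        using r by (intro subsetD[OF r(2)]) (auto simp: dist_norm norm_axis_1)
      then have "norm (aff_app v (p + (r/2) *\<^sub>R axis j 1) - aff_app v p) \<le> R + R"
        using p inK R(2) by (intro order_trans[OF norm_triangle_ineq4] add_mono) auto
      also have "aff_app v (p + (r/2) *\<^sub>R axis j 1) - aff_app v p = (r/2) *\<^sub>R (fst v *v axis j 1)"
        by (simp add: aff_app_def algebra_simps)
      finally have "norm (fst v *v axis j 1) \<le> 4 * R / r"
        using r(1) by (simp add: field_simps)
      moreover have "\<bar>(fst v *v axis j 1) $ i\<bar> \<le> norm (fst v *v axis j 1)"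
        by (rule component_le_norm_cart)
      moreover have "(fst v *v axis j 1) $ i = fst v $ i $ j"
        by (simp add: matrix_vector_mult_basis column_def)
      ultimately show ?thesis by simp
    qed
    have "norm (fst v) \<le> (\<Sum>i\<in>UNIV. norm (fst v $ i))"
      unfolding norm_vec_def by (rule L2_set_le_sum) auto
    also have "\<dots> \<le> (\<Sum>i\<in>UNIV. \<Sum>j\<in>UNIV. \<bar>fst v $ i $ j\<bar>)"
      by (intro sum_mono norm_le_l1_cart)
    also have "\<dots> \<le> M" unfolding M_def by (intro sum_mono ij)
    finally have f: "norm (fst v) \<le> M" .
    have "snd v = aff_app v p - fst v *v p" by (simp add: aff_app_def)
    also have "norm \<dots> \<le> norm (aff_app v p) + norm (fst v *v p)" by (rule norm_triangle_ineq4)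
    also have "\<dots> \<le> R + norm (fst v) * norm p * B"
      using R(2) inK[OF p] B(2) by (intro add_mono) auto
    also have "\<dots> \<le> R + M * norm p * B"
      using f B(1) by (intro add_left_mono mult_right_mono) auto
    finally have "norm (snd v) \<le> R + M * norm p * B" .
    with f have "norm (fst v) + norm (snd v) \<le> M + (R + M * norm p * B)" by linarith
    then show ?thesis using norm_Pair_le[of "fst v" "snd v"] by simp
  qed
  then show ?thesis unfolding bounded_iff by blast
qed

lemma compact_placements:
  assumes "interior K \<noteq> {}" "compact L"
  shows "compact (placements K L)"
  using closed_placements[OF compact_imp_closed[OF assms(2)]]
    bounded_placements[OF assms(1) compact_imp_bounded[OF assms(2)]]
  unfolding compact_eq_bounded_closed by (rule conjI[rotated])

subsection \<open>Convex bodies and the Hausdorff distance\<close>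

lemma convex_bodyD:
  assumes "convex_body K"
  shows "compact K" "convex K" "interior K \<noteq> {}" "K \<noteq> {}" "closed K"
  using assms interior_subset[of K] compact_imp_closed by (auto simp: convex_body_def)

text \<open>The infimum defining \<open>hausdorff_dist\<close> is attained, and so is the distance
  to a closed body; hence nearest points exist with a non-strict bound.\<close>

lemma
  assumes "convex_body K" "convex_body L"
  shows hausdorff_dist_nonneg: "0 \<le> hausdorff_dist K L"
    and hausdorff_dist_nearest_left: "x \<in> K \<Longrightarrow> \<exists>y\<in>L. dist x y \<le> hausdorff_dist K L"
    and hausdorff_dist_nearest_right: "x \<in> L \<Longrightarrow> \<exists>y\<in>K. dist x y \<le> hausdorff_dist K L"
proof -
  note K = convex_bodyD[OF assms(1)] and L = convex_bodyD[OF assms(2)]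
  note h = hausdorff_dist_is_min[OF K(1,4) L(1,4), THEN conjunct1]
  show 0: "0 \<le> hausdorff_dist K L" using h by simp
  show "\<exists>y\<in>L. dist x y \<le> hausdorff_dist K L" if "x \<in> K"
    using h that subset_parallel_body_iff[OF L(1,4) 0, of K] infdist_attains_inf[OF L(5,4), of x]
    by (metis (mono_tags, lifting) mem_Collect_eq)
  show "\<exists>y\<in>K. dist x y \<le> hausdorff_dist K L" if "x \<in> L"
    using h that subset_parallel_body_iff[OF K(1,4) 0, of L] infdist_attains_inf[OF K(5,4), of x]
    by (metis (mono_tags, lifting) mem_Collect_eq)
qed

text \<open>The sequential form is what dominated convergence delivers. Conversely, a failure of
  continuity yields a counterexample sequence with distances below
  \<open>inverse (real (Suc k))\<close>.\<close>

lemma hausdorff_continuous_iff_sequential: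
  fixes P :: "(real^'n) set \<Rightarrow> real^'n"
  shows "hausdorff_continuous P \<longleftrightarrow>
    (\<forall>K L. convex_body K \<longrightarrow> (\<forall>k. convex_body (L k)) \<longrightarrow>
       (\<lambda>k. hausdorff_dist (L k) K) \<longlonglongrightarrow> 0 \<longrightarrow> (\<lambda>k. P (L k)) \<longlonglongrightarrow> P K)"
    (is "_ \<longleftrightarrow> ?seq")
proof
  assume P: "hausdorff_continuous P"
  show ?seq
  proof (intro allI impI)
    fix K :: "(real^'n) set" and L :: "nat \<Rightarrow> (real^'n) set"
    assume K: "convex_body K" and L: "\<forall>k. convex_body (L k)"
      and lim: "(\<lambda>k. hausdorff_dist (L k) K) \<longlonglongrightarrow> 0"
    show "(\<lambda>k. P (L k)) \<longlonglongrightarrow> P K"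
    proof (rule tendstoI)
      fix e :: real assume "e > 0"
      then obtain d where d: "d > 0"
        "\<And>L. convex_body L \<Longrightarrow> hausdorff_dist L K < d \<Longrightarrow> dist (P L) (P K) < e"
        using P K unfolding hausdorff_continuous_def by meson
      show "\<forall>\<^sub>F k in sequentially. dist (P (L k)) (P K) < e"
        using order_tendstoD(2)[OF lim d(1)] by eventually_elim (use d(2) L in blast)
    qed
  qed
next
  assume seq: ?seq
  show "hausdorff_continuous P"
  proof (rule ccontr)
    assume "\<not> hausdorff_continuous P"
    then obtain K e where K: "convex_body K" "e > 0"
      and ex: "\<And>d. d > 0 \<Longrightarrow> \<exists>L. convex_body L \<and> hausdorff_dist L K < d \<and> e \<le> dist (P L) (P K)"
      unfolding hausdorff_continuous_def by (metis not_less)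
    have "\<forall>k. \<exists>L. convex_body L \<and> hausdorff_dist L K < inverse (real (Suc k)) \<and> e \<le> dist (P L) (P K)"
      using ex by simp
    then obtain L where L: "\<And>k. convex_body (L k)"
      "\<And>k. hausdorff_dist (L k) K < inverse (real (Suc k))" "\<And>k. e \<le> dist (P (L k)) (P K)"
      by metis
    have "(\<lambda>k. hausdorff_dist (L k) K) \<longlonglongrightarrow> 0"
    proof (rule tendsto_sandwich[OF _ _ tendsto_const LIMSEQ_inverse_real_of_nat])
      show "\<forall>\<^sub>F k in sequentially. hausdorff_dist (L k) K \<le> inverse (real (Suc k))"
        by (intro always_eventually allI less_imp_le L(2))
    qed (auto intro!: always_eventually hausdorff_dist_nonneg L(1) K(1))
    then have "(\<lambda>k. P (L k)) \<longlonglongrightarrow> P K" using seq K(1) L(1) by blast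
    from tendstoD[OF this K(2)] obtain k where "dist (P (L k)) (P K) < e"
      by (meson eventually_sequentially order_refl)
    with L(3)[of k] show False by simp
  qed
qed

text \<open>If \<open>y\<close> were outside \<open>S\<close>, a hyperplane would separate them.
  Moving from \<open>y\<close> away from \<open>S\<close> by more than \<open>d\<close> but less
  than \<open>r\<close> reaches a point of \<open>L\<close> too far from \<open>S\<close>.\<close>

lemma mem_if_ball_subset_near:
  fixes S L :: "'a::euclidean_space set"
  assumes S: "convex S" "closed S" and y: "ball y r \<subseteq> L"
    and near: "\<And>z. z \<in> L \<Longrightarrow> \<exists>w\<in>S. dist z w \<le> d" and d: "0 \<le> d" "d < r"
  shows "y \<in> S"
proof (rule ccontr)
  assume "y \<notin> S"
  then obtain a b where ab: "inner a y < b" "\<And>x. x \<in> S \<Longrightarrow> inner a x > b"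
    using separating_hyperplane_closed_point[OF S] by blast
  \<comment> \<open>Nonemptiness of \<open>S\<close> rules out a zero normal vector
    \<open>a\<close>.\<close>
  have "\<exists>x. x \<in> S" using near[OF subsetD[OF y], of y] d by auto
  then have a: "a \<noteq> 0" using ab by force
  \<comment> \<open>The length \<open>(d + r) / 2\<close> lies strictly between \<open>d\<close> and
    \<open>r\<close>.\<close>
  define u where "u = ((d + r) / 2) *\<^sub>R (a /\<^sub>R norm a)"
  have nu: "norm u = (d + r) / 2" using a d by (simp add: u_def)
  have au: "inner a u = (d + r) / 2 * norm a"
    using a by (simp add: u_def inner_real_def dot_square_norm power2_eq_square)
  have "y - u \<in> L" using y nu d by (intro subsetD[OF y]) (simp add: dist_norm)
  then obtain w where w: "w \<in> S" "dist (y - u) w \<le> d" using near by blast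
  have "inner a (w - (y - u)) \<le> norm a * d"
    using order_trans[OF norm_cauchy_schwarz[of a "w - (y - u)"]] w(2)
    by (simp add: dist_norm norm_minus_commute mult_left_mono)
  then have "inner a w \<le> inner a y - inner a u + norm a * d" by (simp add: inner_diff_right)
  also have "\<dots> \<le> inner a y" using mult_right_mono[of d r "norm a"] d by (simp add: au algebra_simps)
  finally show False using ab(1) ab(2)[OF w(1)] by simp
qed

text \<open>Gives pointwise convergence of the indicators off the frontier. An interior placement
  has a uniform margin inside \<open>L\<close>, and the preceding lemma transfers it to bodies near
  \<open>L\<close>; a non-placement sends some point of \<open>K\<close> to a positive distance from
  \<open>L\<close>.\<close>

lemma eventually_mem_placements_iff:
  fixes K L :: "(real^'n) set"
  assumes K: "compact K" and L: "convex_body L" and M: "\<And>k. convex_body (M k)"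
    and lim: "(\<lambda>k. hausdorff_dist (M k) L) \<longlonglongrightarrow> 0"
    and v: "v \<notin> frontier (placements K L)"
  shows "\<forall>\<^sub>F k in sequentially. v \<in> placements K (M k) \<longleftrightarrow> v \<in> placements K L"
proof (cases "v \<in> placements K L")
  case True
  have "v \<in> placements K (interior L)"
    using v True interior_placements[OF K] closure_subset unfolding frontier_def by blast
  then have sub: "aff_app v ` K \<subseteq> interior L" by (simp add: placements_def)
  have "compact (aff_app v ` K)"
    using K by (intro compact_continuous_image continuous_intros)
  from compact_subset_open_imp_ball_epsilon_subset[OF this open_interior sub]
  obtain e where e: "e > 0" "(\<Union>x\<in>aff_app v ` K. ball x e) \<subseteq> interior L"
    by metis
  show ?thesis
    using order_tendstoD(2)[OF lim e(1)]
  proof eventually_elim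
    case (elim k)
    have "aff_app v x \<in> M k" if x: "x \<in> K" for x
    proof (rule mem_if_ball_subset_near)
      show "ball (aff_app v x) e \<subseteq> L" using e(2) x interior_subset by blast
      show "\<exists>w\<in>M k. dist z w \<le> hausdorff_dist (M k) L" if "z \<in> L" for z
        using hausdorff_dist_nearest_right[OF M L that] .
    qed (use convex_bodyD[OF M] elim hausdorff_dist_nonneg[OF M L] in auto)
    then show ?case using True by (simp add: placements_iff)
  qed
next
  case False
  then obtain x where x: "x \<in> K" "aff_app v x \<notin> L" by (auto simp: placements_iff)
  have "open (- L)" using convex_bodyD[OF L] by auto
  then obtain e where e: "e > 0" "ball (aff_app v x) e \<subseteq> - L"
    using x(2) by (meson ComplI open_contains_ball)
  show ?thesis
    using order_tendstoD(2)[OF lim e(1)]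
  proof eventually_elim
    case (elim k)
    have "aff_app v x \<notin> M k"
    proof
      assume "aff_app v x \<in> M k"
      then obtain z where "z \<in> L" "dist (aff_app v x) z \<le> hausdorff_dist (M k) L"
        using hausdorff_dist_nearest_left[OF M L] by blast
      then show False using elim e(2) by force
    qed
    then show ?case using x False by (auto simp: placements_iff)
  qed
qed

subsection \<open>Determinants of placements\<close>

lemma inj_aff_app:
  assumes "abs_det v \<noteq> 0"
  shows "inj (aff_app v)"
proof -
  have "inj ((*v) (fst v))"
    using assms by (simp add: abs_det_def inj_matrix_vector_mult invertible_det_nz)
  then show ?thesis by (auto simp: inj_def aff_app_def)
qed

text \<open>The iterates of \<open>v\<close> stay in the compact set \<open>placements K K\<close>,
  so the powers of \<open>abs_det v\<close> are bounded. In the case of equality, recurrence of the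
  iterates makes \<open>v\<close> map \<open>K\<close> onto itself.\<close>

lemma abs_det_self_placement_le_one:
  fixes K :: "(real^'n) set"
  assumes K: "convex_body K" and v: "v \<in> placements K K"
  shows "abs_det v \<le> 1"
    and "abs_det v = 1 \<Longrightarrow> aff_app v ` K = K"
proof -
  note K' = convex_bodyD[OF K]
  have cC: "compact (placements K K)" using K' by (intro compact_placements) auto
  define u where "u m = (aff_comp v ^^ m) (mat 1, 0)" for m
  have uS: "u (Suc m) = aff_comp v (u m)" for m by (simp add: u_def)
  have u0: "aff_app (u 0) x = x" for x by (simp add: u_def aff_app_def)
  have uC: "u m \<in> placements K K" for m
  proof (induction m)
    case 0 then show ?case by (simp add: placements_iff u0)
  next
    case (Suc m) then show ?case using v by (simp add: placements_iff uS aff_app_comp)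
  qed
  have det_u: "abs_det (u m) = abs_det v ^ m" for m
    by (induction m) (simp_all add: uS abs_det_comp, simp add: u_def abs_det_def)
  have u_add: "aff_app (u (m + l)) x = aff_app (u m) (aff_app (u l) x)" for m l x
    by (induction m) (simp_all add: uS aff_app_comp u0)
  show "abs_det v \<le> 1"
  proof (rule ccontr)
    assume "\<not> abs_det v \<le> 1"
    moreover have "compact (abs_det ` placements K K)"
      using cC by (intro compact_continuous_image continuous_intros)
    then obtain B where "\<And>w. w \<in> placements K K \<Longrightarrow> abs_det w \<le> B"
      by (metis bounded_pos compact_imp_bounded imageI abs_le_D1 real_norm_def)
    ultimately show False
      using real_arch_pow[of "abs_det v" B] uC det_u by (metis not_le)
  qed
  assume 1: "abs_det v = 1"
  \<comment> \<open>The iterates of \<open>v\<close> stay in a compact set and have determinant of modulus 1, so some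
    powers of \<open>v\<close> with positive exponent come arbitrarily close to the identity on \<open>K\<close>.\<close>
  from cC uC obtain l r where l: "l \<in> placements K K" "strict_mono r" "(u \<circ> r) \<longlonglongrightarrow> l"
    unfolding compact_def by meson
  have "continuous_on UNIV (abs_det :: (real^'n^'n) \<times> (real^'n) \<Rightarrow> real)"
    by (intro continuous_intros)
  then have "isCont abs_det l"
    by (rule continuous_on_interior) simp
  then have "(\<lambda>j. abs_det ((u \<circ> r) j)) \<longlonglongrightarrow> abs_det l"
    using l(3) by (rule isCont_tendsto_compose)
  then have det_l: "abs_det l = 1"
    using LIMSEQ_unique[OF _ tendsto_const] by (auto simp: det_u 1)
  have cont: "(\<lambda>j. aff_app (f j) (g j)) \<longlonglongrightarrow> aff_app a b"
    if "f \<longlonglongrightarrow> a" "g \<longlonglongrightarrow> b" for f g and a :: "(real^'n^'n) \<times> (real^'n)" and b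
    unfolding aff_app_def
    by (intro tendsto_intros bounded_bilinear.tendsto[OF bounded_bilinear_matrix_vector_mult] that)
  have "x \<in> aff_app v ` K" if x: "x \<in> K" for x
  proof -
    \<comment> \<open>The exponent is positive, so one factor \<open>v\<close> can be split off and
      \<open>y j\<close> lies in the image of \<open>v\<close>.\<close>
    define y where "y j = aff_app (u (r (Suc j) - r j)) x" for j
    have less: "r j < r (Suc j)" for j using l(2) by (simp add: strict_mono_Suc_iff)
    have "y j \<in> aff_app v ` K" for j
    proof -
      obtain d where d: "r (Suc j) - r j = Suc d" using less[of j] by (metis Suc_diff_Suc)
      show ?thesis using uC[of d] x by (auto simp: y_def d uS aff_app_comp placements_iff)
    qed
    moreover have "compact (aff_app v ` K)"
      using K'(1) by (intro compact_continuous_image continuous_intros)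
    ultimately obtain y0 s where y0: "y0 \<in> aff_app v ` K" "strict_mono s" "(y \<circ> s) \<longlonglongrightarrow> y0"
      unfolding compact_def by meson
    have eq: "aff_app (u (r j)) (y j) = aff_app (u (r (Suc j))) x" for j
      using u_add[of "r j" "r (Suc j) - r j" x] less[of j] by (simp add: y_def)
    have "(\<lambda>j. aff_app ((u \<circ> r) (s j)) ((y \<circ> s) j)) \<longlonglongrightarrow> aff_app l y0"
      using LIMSEQ_subseq_LIMSEQ[OF l(3) y0(2)] y0(3) by (intro cont) (auto simp: o_def)
    moreover have "(\<lambda>j. aff_app ((u \<circ> r) (Suc (s j))) x) \<longlonglongrightarrow> aff_app l x"
      using LIMSEQ_subseq_LIMSEQ[OF LIMSEQ_Suc[OF l(3)] y0(2)]
      by (intro cont tendsto_const) (auto simp: o_def)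
    \<comment> \<open>Both sides are limits of the same sequence, by \<open>eq\<close>. Since
      \<open>l\<close> has determinant of modulus 1, it is injective, and \<open>x\<close> is
      identified with a point of the image of \<open>v\<close>.\<close>
    ultimately have "aff_app l y0 = aff_app l x"
      using LIMSEQ_unique by (simp add: eq)
    then have "y0 = x" using inj_aff_app[of l] det_l by (simp add: inj_eq)
    then show ?thesis using y0(1) by simp
  qed
  then show "aff_app v ` K = K" using v by (auto simp: placements_def)
qed

text \<open>A homothety shrinks \<open>K\<close> into a small ball inside \<open>L\<close>. This
  makes the total weighted mass positive.\<close>

lemma ex_interior_placement_abs_det_pos:
  fixes K L :: "(real^'n) set"
  assumes K: "compact K" and L: "interior L \<noteq> {}"
  shows "\<exists>v\<in>interior (placements K L). 0 < abs_det v"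
proof -
  obtain q r where q: "r > 0" "ball q r \<subseteq> interior L"
    using L by (metis all_not_in_conv open_contains_ball open_interior)
  obtain N where N: "N > 0" "\<And>x. x \<in> K \<Longrightarrow> norm x \<le> N"
    using compact_imp_bounded[OF K] by (meson bounded_pos)
  \<comment> \<open>Since \<open>K\<close> has norm at most \<open>N\<close>, this ratio puts its
    image within \<open>r / 2\<close> of \<open>q\<close>.\<close>
  define s where "s = r / (2 * N)"
  have s: "s > 0" using q N by (simp add: s_def)
  let ?v = "(s *\<^sub>R mat 1, q) :: (real^'n^'n) \<times> (real^'n)"
  have "aff_app ?v x \<in> interior L" if x: "x \<in> K" for x
  proof (rule subsetD[OF q(2)])
    have "s * norm x \<le> s * N" using s N(2)[OF x] by simp
    also have "\<dots> < r" using q N by (simp add: s_def)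
    finally show "aff_app ?v x \<in> ball q r"
      using s by (simp add: aff_app_def dist_norm scaleR_matrix_vector_assoc[symmetric])
  qed
  then have "?v \<in> interior (placements K L)"
    by (simp add: interior_placements[OF K] placements_iff)
  moreover have "invertible (s *\<^sub>R mat 1 :: real^'n^'n)"
    unfolding invertible_def
    by (rule exI[of _ "(1/s) *\<^sub>R mat 1"]) (use s in \<open>simp add: matrix_scalar_ac scalar_matrix_assoc[symmetric]\<close>)
  ultimately show ?thesis by (auto simp: abs_det_def invertible_det_nz intro!: bexI[of _ ?v])
qed

text \<open>The contraction by \<open>1 - t\<close> towards an interior point \<open>p\<close> maps
  \<open>K\<close> into its interior, and its determinant tends to 1 as \<open>t\<close> decreases
  to 0.\<close>

lemma ex_interior_self_placement_abs_det:
  fixes K :: "(real^'n) set"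
  assumes K: "convex_body K" and q: "q < 1"
  shows "\<exists>v\<in>interior (placements K K). q < abs_det v"
proof -
  note K' = convex_bodyD[OF K]
  obtain p where p: "p \<in> interior K" using K'(3) by blast
  define v :: "real \<Rightarrow> (real^'n^'n) \<times> (real^'n)" where "v t = ((1 - t) *\<^sub>R mat 1, t *\<^sub>R p)" for t
  have "continuous_on UNIV (\<lambda>t. abs_det (v t))"
    unfolding v_def by (intro continuous_intros)
  then have "((\<lambda>t. abs_det (v t)) \<longlongrightarrow> abs_det (v 0)) (at_right 0)"
    by (meson UNIV_I at_le continuous_on_def tendsto_mono top_greatest)
  then have "\<forall>\<^sub>F t in at_right 0. q < abs_det (v t)"
    using q by (intro order_tendstoD(1)) (auto simp: v_def abs_det_def)
  moreover have "\<forall>\<^sub>F t in at_right (0::real). t < 1"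
    by (intro order_tendstoD(2)[OF tendsto_ident_at]) simp
  ultimately have "\<forall>\<^sub>F t in at_right 0. q < abs_det (v t) \<and> t < 1 \<and> 0 < t"
    using eventually_at_right_less[of 0] by eventually_elim simp
  then obtain t where t: "q < abs_det (v t)" "t < 1" "0 < t"
    using eventually_happens'[OF trivial_limit_at_right_real] by blast
  have "aff_app (v t) x \<in> interior K" if "x \<in> K" for x
  proof -
    have "aff_app (v t) x = x - t *\<^sub>R (x - p)"
      by (simp add: v_def aff_app_def scaleR_matrix_vector_assoc[symmetric] algebra_simps)
    then show ?thesis using mem_interior_convex_shrink[OF K'(2) p that] t by simp
  qed
  then show ?thesis using t(1) by (auto simp: interior_placements[OF K'(1)] placements_iff)
qed

subsection \<open>Determinant-weighted means\<close>

text \<open>The range of \<open>f\<close> is left general so that the vector-valued numerator and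
  the real total mass of the mean are both instances.\<close>

definition placement_integral ::
  "(real^'n) set \<Rightarrow> nat \<Rightarrow> ((real^'n^'n) \<times> (real^'n) \<Rightarrow> 'b::euclidean_space) \<Rightarrow> (real^'n) set \<Rightarrow> 'b" where
  "placement_integral K m f L = (\<integral>v. (indicator (placements K L) v * abs_det v ^ m) *\<^sub>R f v \<partial>lborel)"

definition placement_mean :: "(real^'n) set \<Rightarrow> nat \<Rightarrow> real^'n \<Rightarrow> (real^'n) set \<Rightarrow> real^'n" where
  "placement_mean K m x L =
     placement_integral K m (\<lambda>v. aff_app v x) L /\<^sub>R placement_integral K m (\<lambda>_. 1) L"

lemma integrable_placement:
  fixes f :: "(real^'n^'n) \<times> (real^'n) \<Rightarrow> 'b::euclidean_space"
  assumes "convex_body K" "compact L" "continuous_on UNIV f"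
  shows "integrable lborel (\<lambda>v. (indicator (placements K L) v * abs_det v ^ m) *\<^sub>R f v)"
proof -
  have "integrable lborel (\<lambda>v. indicator (placements K L) v *\<^sub>R (abs_det v ^ m *\<^sub>R f v))"
    by (intro borel_integrable_compact compact_placements convex_bodyD(3) continuous_intros
        continuous_on_subset[OF assms(3)] assms subset_UNIV)
  then show ?thesis by (simp add: scaleR_scaleR)
qed

text \<open>Lower bound for the total mass from a single ball of placements; it serves both for
  positivity and for the growth rate in \<open>m\<close>.\<close>

lemma placement_integral_ge:
  fixes K L :: "(real^'n) set"
  assumes K: "convex_body K" and L: "compact L"
    and r: "0 < r" "ball v r \<subseteq> placements K L"
    and c: "0 \<le> c" "\<forall>w\<in>ball v r. c \<le> abs_det w"
  shows "c ^ m * measure lborel (ball v r) \<le> placement_integral K m (\<lambda>_. 1::real) L"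
proof -
  have "c ^ m * measure lborel (ball v r) = (\<integral>w. c ^ m * indicator (ball v r) w \<partial>lborel)"
    by simp
  also have "\<dots> \<le> placement_integral K m (\<lambda>_. 1::real) L"
    unfolding placement_integral_def
  proof (rule integral_mono)
    show "integrable lborel (\<lambda>w. c ^ m * indicator (ball v r) w)"
      using emeasure_bounded_finite[of "ball v r"] by simp
    show "integrable lborel (\<lambda>w. (indicator (placements K L) w * abs_det w ^ m) *\<^sub>R (1::real))"
      using integrable_placement[OF K L, of "\<lambda>_. 1::real"] by simp
  qed (use r c in \<open>auto simp: indicator_def intro!: power_mono\<close>)
  finally show ?thesis .
qed

lemma ex_ball_abs_det_greater:
  assumes "v \<in> interior C" "c < abs_det v"
  obtains r where "r > 0" "ball v r \<subseteq> C" "\<forall>w\<in>ball v r. c \<le> abs_det w"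
proof -
  have "open (interior C \<inter> abs_det -` {c<..})"
    by (intro open_Int open_interior open_vimage continuous_intros open_greaterThan)
  moreover have "v \<in> interior C \<inter> abs_det -` {c<..}" using assms by simp
  ultimately obtain r where r: "r > 0" "ball v r \<subseteq> interior C \<inter> abs_det -` {c<..}"
    by (meson open_contains_ball)
  show ?thesis
  proof (rule that[OF r(1)])
    show "ball v r \<subseteq> C" using r(2) interior_subset[of C] by blast
    show "\<forall>w\<in>ball v r. c \<le> abs_det w" using r(2) by auto
  qed
qed

lemma placement_integral_pos:
  fixes K L :: "(real^'n) set"
  assumes K: "convex_body K" and L: "convex_body L"
  shows "0 < placement_integral K m (\<lambda>_. 1::real) L"
proof -
  obtain v where v: "v \<in> interior (placements K L)" "0 < abs_det v"
    using ex_interior_placement_abs_det_pos convex_bodyD[OF K] convex_bodyD[OF L] by blast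
  then obtain r where r: "r > 0" "ball v r \<subseteq> placements K L"
    "\<forall>w\<in>ball v r. abs_det v / 2 \<le> abs_det w"
    using ex_ball_abs_det_greater[of v "placements K L" "abs_det v / 2"] by auto
  have "0 < (abs_det v / 2) ^ m * measure lborel (ball v r)"
    using v(2) content_ball_pos[OF r(1)] by simp
  also have "\<dots> \<le> placement_integral K m (\<lambda>_. 1::real) L"
    using placement_integral_ge[OF K convex_bodyD(1)[OF L] r(1,2) _ r(3)] by simp
  finally show ?thesis .
qed

text \<open>Dominated convergence: all the bodies \<open>M k\<close> lie in one ball, whose
  placements give an integrable majorant, and the integrands converge off the null set
  \<open>frontier (placements K L)\<close>.\<close>

lemma tendsto_placement_integral:
  fixes f :: "(real^'n^'n) \<times> (real^'n) \<Rightarrow> 'b::euclidean_space"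
  assumes K: "convex_body K" and L: "convex_body L" and M: "\<And>k. convex_body (M k)"
    and lim: "(\<lambda>k. hausdorff_dist (M k) L) \<longlonglongrightarrow> 0" and f: "continuous_on UNIV f"
  shows "(\<lambda>k. placement_integral K m f (M k)) \<longlonglongrightarrow> placement_integral K m f L"
proof -
  obtain d where d: "\<And>k. hausdorff_dist (M k) L \<le> d"
    using convergent_imp_Bseq[OF convergentI[OF lim]] by (metis BseqE abs_le_D1 real_norm_def)
  obtain R where R: "\<And>x. x \<in> L \<Longrightarrow> norm x \<le> R"
    using compact_imp_bounded[OF convex_bodyD(1)[OF L]] by (meson bounded_iff)
  have Msub: "M k \<subseteq> cball 0 (R + d)" for k
  proof
    fix x assume "x \<in> M k"
    then obtain y where y: "y \<in> L" "dist x y \<le> hausdorff_dist (M k) L"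
      using hausdorff_dist_nearest_left[OF M L] by blast
    have "norm x \<le> norm y + dist x y" by (metis dist_norm norm_triangle_sub)
    then show "x \<in> cball 0 (R + d)" using R[OF y(1)] y(2) d[of k] by simp
  qed
  let ?S = "placements K (cball 0 (R + d))"
  let ?g = "\<lambda>X v. (indicator (placements K X) v * abs_det v ^ m) *\<^sub>R f v"
  have sub: "placements K (M k) \<subseteq> ?S" for k
    using Msub[of k] unfolding placements_def by blast
  have "integrable lborel (\<lambda>v. (indicator ?S v * abs_det v ^ m) *\<^sub>R norm (f v))"
    using f by (intro integrable_placement[OF K] continuous_intros) auto
  moreover have "?g L \<in> borel_measurable lborel" "?g (M k) \<in> borel_measurable lborel" for k
    by (rule borel_measurable_integrable[OF integrable_placement[OF K convex_bodyD(1) f]]; fact)+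
  moreover have "AE v in lborel. norm (?g (M k) v) \<le> (indicator ?S v * abs_det v ^ m) *\<^sub>R norm (f v)" for k
    using sub[of k] by (auto simp: indicator_def)
  moreover have "AE v in lborel. (\<lambda>k. ?g (M k) v) \<longlonglongrightarrow> ?g L v"
  proof -
    \<comment> \<open>Negligibility refers to the completed measure; the frontier is closed, hence
      Borel, so it is also null for \<open>lborel\<close>.\<close>
    have "frontier (placements K L) \<in> null_sets lborel"
      using negligible_convex_frontier[OF convex_placements[OF convex_bodyD(2)[OF L]], of K]
      unfolding negligible_iff_null_sets by (subst (asm) null_sets_completion_iff) auto
    then have "AE v in lborel. v \<notin> frontier (placements K L)" by (rule AE_not_in)
    then show ?thesis
    proof eventually_elim
      case (elim v)
      have "\<forall>\<^sub>F k in sequentially. ?g (M k) v = ?g L v"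
        using eventually_mem_placements_iff[OF convex_bodyD(1)[OF K] L M lim elim]
        by eventually_elim (simp add: indicator_def)
      then show ?case by (rule tendsto_eventually)
    qed
  qed
  ultimately show ?thesis
    unfolding placement_integral_def by (intro integral_dominated_convergence)
qed

lemma placement_mean_sequentially_continuous:
  assumes "convex_body K" "convex_body L" "\<And>k. convex_body (M k)"
    and "(\<lambda>k. hausdorff_dist (M k) L) \<longlonglongrightarrow> 0"
  shows "(\<lambda>k. placement_mean K m x (M k)) \<longlonglongrightarrow> placement_mean K m x L"
  unfolding placement_mean_def
  using placement_integral_pos[OF assms(1,2), of m]
  by (intro tendsto_intros tendsto_placement_integral[OF assms] continuous_intros) auto

text \<open>Composition with the affine map carries the placements in \<open>L\<close> bijectively
  to those in its image. It multiplies Lebesgue measure and the weight by constants, which cancel in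
  the mean.\<close>

lemma placement_mean_equivariant:
  fixes K L :: "(real^'n) set"
  assumes K: "convex_body K" and L: "convex_body L" and A: "invertible A"
  shows "placement_mean K m x ((\<lambda>y. A *v y + b) ` L) = A *v placement_mean K m x L + b"
proof -
  obtain B where B: "A ** B = mat 1" "B ** A = mat 1"
    using A unfolding invertible_def by blast
  define h where "h = (A, b)"
  have app_h: "aff_app h y = A *v y + b" for y by (simp add: h_def aff_app_def)
  have dh: "abs_det h > 0" using A by (simp add: h_def abs_det_def invertible_det_nz)
  define T where "T = aff_comp h"
  have T: "T \<in> borel_measurable borel"
    unfolding T_def by (intro borel_measurable_continuous_onI continuous_on_aff_comp)
  \<comment> \<open>Composition with \<open>h\<close> multiplies differences by \<open>A\<close>, so
    a translation by \<open>w\<close> after \<open>T\<close> comes from applying \<open>B\<close> to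
    both parts of \<open>w\<close> before it.\<close>
  have T_add: "T (v + (B ** fst w, B *v snd w)) = T v + w" for v w
    by (simp add: T_def h_def aff_comp_def matrix_add_ldistrib matrix_vector_right_distrib
        matrix_mul_assoc matrix_vector_mul_assoc B prod_eq_iff)
  have T_inv: "aff_comp (B, - (B *v b)) (T v) = v" for v
    by (simp add: T_def h_def aff_comp_def matrix_vector_right_distrib
        matrix_mul_assoc matrix_vector_mul_assoc B prod_eq_iff)
  obtain k :: real where k: "k > 0" "distr lborel borel T = density lborel (\<lambda>_. ennreal k)"
    using distr_lborel_equivariant[OF T T_add continuous_on_aff_comp T_inv] .
  have mem: "T v \<in> placements K (aff_app h ` L) \<longleftrightarrow> v \<in> placements K L" for v
    using inj_aff_app[of h] dh by (auto simp: placements_iff T_def aff_app_comp inj_image_mem_iff)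
  have cL: "compact (aff_app h ` L)"
    using convex_bodyD(1)[OF L] by (intro compact_continuous_image continuous_intros)
  have change: "k *\<^sub>R placement_integral K m f (aff_app h ` L)
      = abs_det h ^ m *\<^sub>R placement_integral K m (\<lambda>v. f (T v)) L"
    if f: "continuous_on UNIV f" for f :: "_ \<Rightarrow> 'c::euclidean_space"
  proof -
    let ?g = "\<lambda>v. (indicator (placements K (aff_app h ` L)) v * abs_det v ^ m) *\<^sub>R f v"
    have "?g \<in> borel_measurable borel"
      using borel_measurable_integrable[OF integrable_placement[OF K cL f]] by simp
    then have "k *\<^sub>R placement_integral K m f (aff_app h ` L) = (\<integral>v. ?g (T v) \<partial>lborel)"
      unfolding placement_integral_def by (rule integral_scaled_distr[OF T k(2,1), symmetric])
    also have "\<dots> = (\<integral>v. abs_det h ^ m *\<^sub>R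
        ((indicator (placements K L) v * abs_det v ^ m) *\<^sub>R f (T v)) \<partial>lborel)"
      using mem by (intro Bochner_Integration.integral_cong)
        (auto simp: T_def abs_det_comp power_mult_distrib indicator_def)
    also have "\<dots> = abs_det h ^ m *\<^sub>R placement_integral K m (\<lambda>v. f (T v)) L"
      unfolding placement_integral_def by (rule integral_scaleR_right)
    finally show ?thesis .
  qed
  let ?N = "placement_integral K m (\<lambda>v. aff_app v x)" and ?W = "placement_integral K m (\<lambda>_. 1::real)"
  have W: "k * ?W (aff_app h ` L) = abs_det h ^ m * ?W L"
    using change[of "\<lambda>_. 1::real"] by simp
  \<comment> \<open>Integration commutes with \<open>A\<close>, while the translation part
    \<open>b\<close> picks up the total mass.\<close>
  have "placement_integral K m (\<lambda>v. aff_app (T v) x) L = A *v ?N L + ?W L *\<^sub>R b"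
  proof -
    let ?i = "\<lambda>v. indicator (placements K L) v * abs_det v ^ m :: real"
    have 1: "integrable lborel (\<lambda>v. ?i v *\<^sub>R aff_app v x)"
      by (intro integrable_placement K convex_bodyD[OF L] continuous_intros)
    have 2: "integrable lborel (\<lambda>v. ?i v *\<^sub>R (1::real))"
      by (intro integrable_placement K convex_bodyD[OF L] continuous_intros)
    have "placement_integral K m (\<lambda>v. aff_app (T v) x) L
        = (\<integral>v. A *v (?i v *\<^sub>R aff_app v x) + ?i v *\<^sub>R b \<partial>lborel)"
      unfolding placement_integral_def T_def aff_app_comp app_h
      by (simp add: algebra_simps)
    also have "\<dots> = (\<integral>v. A *v (?i v *\<^sub>R aff_app v x) \<partial>lborel) + (\<integral>v. ?i v *\<^sub>R b \<partial>lborel)"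
      using 1 2 by (intro Bochner_Integration.integral_add
          integrable_bounded_linear[OF matrix_vector_mul_bounded_linear]) auto
    also have "(\<integral>v. A *v (?i v *\<^sub>R aff_app v x) \<partial>lborel) = A *v ?N L"
      unfolding placement_integral_def
      by (rule integral_bounded_linear[OF matrix_vector_mul_bounded_linear 1])
    also have "(\<integral>v. ?i v *\<^sub>R b \<partial>lborel) = ?W L *\<^sub>R b"
      unfolding placement_integral_def using 2 by simp
    finally show ?thesis .
  qed
  then have N: "k *\<^sub>R ?N (aff_app h ` L) = abs_det h ^ m *\<^sub>R (A *v ?N L + ?W L *\<^sub>R b)"
    using change[of "\<lambda>v. aff_app v x"] by (simp add: continuous_intros)
  have Wpos: "?W L > 0" using placement_integral_pos[OF K L] .
  \<comment> \<open>The factors \<open>k\<close> and \<open>abs_det h ^ m\<close> occur in numerator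
    and denominator alike.\<close>
  have "placement_mean K m x (aff_app h ` L)
      = (k *\<^sub>R ?N (aff_app h ` L)) /\<^sub>R (k * ?W (aff_app h ` L))"
    using k(1) by (simp add: placement_mean_def)
  also have "\<dots> = (A *v ?N L + ?W L *\<^sub>R b) /\<^sub>R ?W L"
    unfolding N W using dh by simp
  also have "\<dots> = A *v placement_mean K m x L + b"
    using Wpos by (simp add: placement_mean_def algebra_simps)
  finally show ?thesis by (simp add: app_h)
qed

lemma affine_invariant_point_placement_mean:
  fixes K :: "(real^'n) set"
  assumes "convex_body K"
  shows "affine_invariant_point (placement_mean K m x)"
  unfolding affine_invariant_point_def hausdorff_continuous_iff_sequential nonsingular_affine_map_def
proof (intro conjI allI impI)
  fix \<phi> :: "real^'n \<Rightarrow> real^'n" and L :: "(real^'n) set"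
  assume "\<exists>A b. invertible A \<and> (\<forall>x. \<phi> x = A *v x + b)" and L: "convex_body L"
  then obtain A b where "invertible A" "\<phi> = (\<lambda>x. A *v x + b)" by blast
  then show "placement_mean K m x (\<phi> ` L) = \<phi> (placement_mean K m x L)"
    using placement_mean_equivariant[OF assms L] by simp
qed (use placement_mean_sequentially_continuous[OF assms] in blast)

text \<open>A concentration argument: placements moving \<open>x\<close> noticeably have determinant
  of modulus at most some \<open>q < 1\<close>, so their weight decays like \<open>q ^ m\<close>,
  while the total mass is at least a constant times \<open>p ^ m\<close> with
  \<open>p > q\<close>.\<close>

lemma placement_mean_approximates_fixed_point:
  fixes K :: "(real^'n) set"
  assumes K: "convex_body K" and x: "x \<in> affine_fixed_points K" and e: "e > 0"
  obtains m where "norm (placement_mean K m x K - x) < e"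
proof -
  note K' = convex_bodyD[OF K]
  let ?C = "placements K K"
  define f where "f = (\<lambda>v. aff_app v x - x)"
  have f_cont: "continuous_on S f" for S unfolding f_def by (intro continuous_intros)
  have C: "compact ?C" using K' by (intro compact_placements) auto
  \<comment> \<open>The placements that move \<open>x\<close> by at least \<open>e / 2\<close>; none
    of them can be an automorphism of \<open>K\<close>.\<close>
  define S where "S = ?C \<inter> (norm \<circ> f) -` {e/2..}"
  have "closed ((norm \<circ> f) -` {e/2..})"
    unfolding o_def by (intro closed_vimage continuous_intros f_cont closed_atLeast)
  then have S: "compact S" unfolding S_def using C by (rule compact_Int_closed[rotated])
  have S_less: "abs_det v < 1" if v: "v \<in> S" for v
  proof (rule ccontr)
    assume "\<not> abs_det v < 1"
    moreover have vC: "v \<in> ?C" using v by (simp add: S_def)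
    ultimately have "abs_det v = 1" using abs_det_self_placement_le_one(1)[OF K vC] by simp
    then have "aff_app v ` K = K" by (rule abs_det_self_placement_le_one(2)[OF K vC])
    moreover have "affine_map (aff_app v)" unfolding affine_map_def aff_app_def by blast
    ultimately have "aff_app v x = x" using x unfolding affine_fixed_points_def by blast
    then have "f v = 0" by (simp add: f_def)
    then show False using v e by (simp add: S_def)
  qed
  \<comment> \<open>By compactness the strict bound on \<open>S\<close> is uniform; if
    \<open>S\<close> is empty, \<open>q = 0\<close> serves.\<close>
  obtain q where q: "0 \<le> q" "q < 1" "\<forall>v\<in>S. abs_det v \<le> q"
  proof (cases "S = {}")
    case True
    then show ?thesis using that[of 0] by simp
  next
    case False
    obtain v where v: "v \<in> S" "\<forall>w\<in>S. abs_det w \<le> abs_det v"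
      using continuous_attains_sup[OF S False continuous_on_abs_det[OF continuous_on_id]] by blast
    show ?thesis by (rule that[of "abs_det v"]) (simp_all add: v S_less)
  qed
  define p where "p = (q + 1) / 2"
  have p: "0 < p" "q < p" "p < 1" using q by (auto simp: p_def)
  obtain v where v: "v \<in> interior ?C" "p < abs_det v"
    using ex_interior_self_placement_abs_det[OF K p(3)] by blast
  obtain r where r: "r > 0" "ball v r \<subseteq> ?C" "\<forall>w\<in>ball v r. p \<le> abs_det w"
    using ex_ball_abs_det_greater[OF v] .
  define \<mu> where "\<mu> = measure lborel (ball v r)"
  have \<mu>: "\<mu> > 0" unfolding \<mu>_def by (rule content_ball_pos[OF r(1)])
  have "compact (f ` ?C)" by (intro compact_continuous_image f_cont C)
  then have "bounded (f ` ?C)" by (rule compact_imp_bounded)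
  then obtain B where B: "B > 0" "\<And>v. v \<in> ?C \<Longrightarrow> norm (f v) \<le> B"
    unfolding bounded_pos by blast
  \<comment> \<open>Chosen so that the contribution of \<open>S\<close>, divided by the lower bound
    \<open>p ^ m * \<mu>\<close> for the mass, equals \<open>(q / p) ^ m * c\<close>.\<close>
  define c where "c = B * measure lborel ?C / \<mu>"
  have "(\<lambda>m. (q / p) ^ m * c) \<longlonglongrightarrow> 0"
    using p q by (intro tendsto_mult_left_zero LIMSEQ_realpow_zero) auto
  then have "\<forall>\<^sub>F m in sequentially. (q / p) ^ m * c < e / 2"
    using e by (intro order_tendstoD(2)) auto
  then obtain m where m: "(q / p) ^ m * c < e / 2"
    by (meson eventually_sequentially order_refl)
  let ?i = "\<lambda>v. indicator ?C v * abs_det v ^ m :: real"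
  define W where "W = placement_integral K m (\<lambda>_. 1::real) K"
  have W: "p ^ m * \<mu> \<le> W"
    unfolding W_def \<mu>_def using p by (intro placement_integral_ge[OF K K'(1) r(1,2) _ r(3)]) auto
  have Wpos: "W > 0" unfolding W_def by (rule placement_integral_pos[OF K K])
  note int = integrable_placement[OF K K'(1), where m = m]
  have int1: "integrable lborel (\<lambda>v. ?i v *\<^sub>R (1::real))" by (intro int continuous_intros)
  have int2: "integrable lborel (\<lambda>v. ?i v *\<^sub>R aff_app v x)" by (intro int continuous_intros)
  have int3: "integrable lborel (\<lambda>v. ?i v *\<^sub>R f v)" by (intro int f_cont)
  have intC: "integrable lborel (indicator ?C :: _ \<Rightarrow> real)"
    using emeasure_bounded_finite[OF compact_imp_bounded[OF C]] compact_imp_closed[OF C] by simp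
  have diff: "placement_integral K m (\<lambda>v. aff_app v x) K - W *\<^sub>R x = (\<integral>v. ?i v *\<^sub>R f v \<partial>lborel)"
  proof -
    have "(\<integral>v. ?i v *\<^sub>R f v \<partial>lborel) = (\<integral>v. ?i v *\<^sub>R aff_app v x - ?i v *\<^sub>R x \<partial>lborel)"
      by (simp add: f_def scaleR_diff_right)
    also have "\<dots> = (\<integral>v. ?i v *\<^sub>R aff_app v x \<partial>lborel) - (\<integral>v. ?i v *\<^sub>R x \<partial>lborel)"
      using int1 int2 by (intro Bochner_Integration.integral_diff) auto
    also have "(\<integral>v. ?i v *\<^sub>R x \<partial>lborel) = W *\<^sub>R x"
      using int1 by (simp add: W_def placement_integral_def)
    finally show ?thesis by (simp add: placement_integral_def)
  qed
  have "norm (\<integral>v. ?i v *\<^sub>R f v \<partial>lborel) \<le> (\<integral>v. norm (?i v *\<^sub>R f v) \<partial>lborel)"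
    by (rule integral_norm_bound)
  \<comment> \<open>The first summand bounds the integrand off \<open>S\<close>, where the
    displacement is below \<open>e / 2\<close>; the second bounds it on \<open>S\<close>, where the
    weight is at most \<open>q ^ m\<close>.\<close>
  also have "\<dots> \<le> (\<integral>v. (e / 2) * ?i v + (q ^ m * B) * indicator ?C v \<partial>lborel)"
  proof (rule integral_mono)
    show "integrable lborel (\<lambda>v. norm (?i v *\<^sub>R f v))"
      using int3 by (rule integrable_norm)
    show "integrable lborel (\<lambda>v. (e / 2) * ?i v + (q ^ m * B) * indicator ?C v)"
      using int1 intC by (intro Bochner_Integration.integrable_add integrable_mult_right) auto
    fix v
    show "norm (?i v *\<^sub>R f v) \<le> (e / 2) * ?i v + (q ^ m * B) * indicator ?C v"
    proof (cases "v \<in> ?C")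
      case vC: True
      have "abs_det v ^ m * norm (f v) \<le> (e / 2) * abs_det v ^ m + q ^ m * B"
      proof (cases "v \<in> S")
        case True
        then have "abs_det v ^ m * norm (f v) \<le> q ^ m * B"
          using q B(2)[OF vC] by (intro mult_mono power_mono) auto
        moreover have "0 \<le> (e / 2) * abs_det v ^ m" using e by simp
        ultimately show ?thesis by linarith
      next
        case False
        then have "norm (f v) \<le> e / 2" using vC by (simp add: S_def)
        then have "abs_det v ^ m * norm (f v) \<le> abs_det v ^ m * (e / 2)"
          by (intro mult_left_mono) auto
        moreover have "0 \<le> q ^ m * B" using q B by simp
        ultimately show ?thesis by (simp add: mult.commute)
      qed
      then show ?thesis using vC by simp
    qed simp
  qed
  also have "\<dots> = e / 2 * W + q ^ m * B * measure lborel ?C"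
    using int1 intC by (simp add: W_def placement_integral_def)
  finally have bound: "norm (\<integral>v. ?i v *\<^sub>R f v \<partial>lborel) \<le> e / 2 * W + q ^ m * B * measure lborel ?C" .
  have "placement_mean K m x K - x = (placement_integral K m (\<lambda>v. aff_app v x) K - W *\<^sub>R x) /\<^sub>R W"
    using Wpos by (simp add: placement_mean_def W_def scaleR_diff_right)
  then have "norm (placement_mean K m x K - x) = norm (\<integral>v. ?i v *\<^sub>R f v \<partial>lborel) / W"
    using Wpos by (simp add: diff divide_inverse mult.commute)
  also have "\<dots> \<le> (e / 2 * W + q ^ m * B * measure lborel ?C) / W"
    using bound Wpos by (intro divide_right_mono) auto
  also have "\<dots> = e / 2 + q ^ m * B * measure lborel ?C / W"
    using Wpos by (simp add: add_divide_distrib)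
  also have "\<dots> \<le> e / 2 + q ^ m * B * measure lborel ?C / (p ^ m * \<mu>)"
    using W Wpos p \<mu> q B by (intro add_left_mono divide_left_mono) auto
  also have "\<dots> = e / 2 + (q / p) ^ m * c"
    by (simp add: c_def power_divide)
  also have "\<dots> < e" using m by linarith
  finally show ?thesis by (rule that)
qed

section \<open>The set of values at a fixed body and the two inclusions\<close>

text \<open>Bridges the two definitions: fixed points refer to all affine maps, equivariance to
  nonsingular ones. Since the image contains a ball, rescaled differences of image points reach
  every vector, so the matrix is surjective.\<close>

lemma nonsingular_affine_map_if_image_eq:
  fixes K :: "(real^'n) set"
  assumes K: "interior K \<noteq> {}" and "affine_map \<phi>" and im: "\<phi> ` K = K"
  shows "nonsingular_affine_map \<phi>"
proof -
  obtain A b where \<phi>: "\<And>x. \<phi> x = A *v x + b" using assms(2) by (auto simp: affine_map_def)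
  obtain p r where r: "r > 0" "ball p r \<subseteq> K" using K mem_interior by blast
  have "\<exists>x. A *v x = y" for y
  proof -
    \<comment> \<open>The summand 1 keeps the denominator positive when
      \<open>y = 0\<close>.\<close>
    define t where "t = r / (2 * (norm y + 1))"
    have "t * norm y < r" "t > 0" using r(1)
      by (simp_all add: t_def field_simps add_pos_nonneg add_strict_increasing2)
    then have "p \<in> \<phi> ` K" "p + t *\<^sub>R y \<in> \<phi> ` K"
      unfolding im using r by (auto intro!: subsetD[OF r(2)] simp: dist_norm)
    then obtain u w where uw: "p = A *v u + b" "p + t *\<^sub>R y = A *v w + b"
      by (auto simp: \<phi>)
    have "A *v (w - u) = (A *v w + b) - (A *v u + b)"
      by (simp add: matrix_vector_mult_diff_distrib)
    also have "\<dots> = t *\<^sub>R y"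
      unfolding uw(2)[symmetric] by (simp add: uw(1)[symmetric])
    finally have "A *v (w - u) = t *\<^sub>R y" .
    then have "A *v ((1 / t) *\<^sub>R (w - u)) = y"
      using \<open>t > 0\<close> by (simp add: matrix_vector_mult_scaleR)
    then show ?thesis by blast
  qed
  then have "surj ((*v) A)" by (metis surjI surj_def)
  then have "invertible A"
    by (simp add: matrix_right_invertible_surjective invertible_right_inverse)
  then show ?thesis using \<phi> by (auto simp: nonsingular_affine_map_def)
qed

text \<open>Coefficients summing to 1 reproduce the translation part of an affine map exactly once,
  so affine combinations of affine-invariant points are again such points. Affine sets are closed,
  which turns approximation into equality.\<close>

lemma affine_affine_invariant_values:
  fixes K :: "(real^'n) set"
  assumes "convex_body K"
  shows "affine (affine_invariant_values K)"
  unfolding affine_def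
proof (intro ballI allI impI)
  fix x y :: "real^'n" and s t :: real
  assume "x \<in> affine_invariant_values K" "y \<in> affine_invariant_values K" and st: "s + t = 1"
  then obtain P Q where PQ: "affine_invariant_point P" "affine_invariant_point Q"
    and xy: "x = P K" "y = Q K"
    by (auto simp: affine_invariant_values_def)
  let ?R = "\<lambda>L. s *\<^sub>R P L + t *\<^sub>R Q L"
  have "affine_invariant_point ?R"
    unfolding affine_invariant_point_def
  proof (intro conjI allI impI)
    fix \<phi> :: "real^'n \<Rightarrow> real^'n" and L :: "(real^'n) set"
    assume *: "nonsingular_affine_map \<phi>" "convex_body L"
    then obtain A b where \<phi>: "\<And>x. \<phi> x = A *v x + b" by (auto simp: nonsingular_affine_map_def)
    have "P (\<phi> ` L) = \<phi> (P L)" "Q (\<phi> ` L) = \<phi> (Q L)"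
      using PQ * by (auto simp: affine_invariant_point_def)
    then have "?R (\<phi> ` L) = A *v ?R L + (s + t) *\<^sub>R b"
      by (simp add: \<phi> algebra_simps)
    then show "?R (\<phi> ` L) = \<phi> (?R L)" by (simp add: \<phi> st)
  next
    have "hausdorff_continuous P" "hausdorff_continuous Q"
      using PQ by (auto simp: affine_invariant_point_def)
    then show "hausdorff_continuous ?R"
      unfolding hausdorff_continuous_iff_sequential by (auto intro!: tendsto_intros)
  qed
  then show "s *\<^sub>R x + t *\<^sub>R y \<in> affine_invariant_values K"
    unfolding affine_invariant_values_def xy by (intro CollectI exI[of _ ?R] conjI refl)
qed

theorem mainTheorem1:
  fixes K :: "(real ^ 'n) set"
  assumes "convex_body K"
  shows "affine_invariant_values K = affine_fixed_points K"
proof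
  show "affine_invariant_values K \<subseteq> affine_fixed_points K"
    \<comment> \<open>An affine map with image \<open>K\<close> is nonsingular, so equivariance at
      \<open>K\<close> says that it fixes the value at \<open>K\<close>.\<close>
    using nonsingular_affine_map_if_image_eq[OF convex_bodyD(3)[OF assms]] assms
    by (force simp: affine_invariant_values_def affine_fixed_points_def affine_invariant_point_def)
  show "affine_fixed_points K \<subseteq> affine_invariant_values K"
  proof
    fix x assume x: "x \<in> affine_fixed_points K"
    have "x \<in> closure (affine_invariant_values K)"
      unfolding closure_approachable
    proof (intro allI impI)
      fix e :: real assume "e > 0"
      then obtain m where "norm (placement_mean K m x K - x) < e"
        by (rule placement_mean_approximates_fixed_point[OF assms x])
      moreover have "placement_mean K m x K \<in> affine_invariant_values K"
        using affine_invariant_point_placement_mean[OF assms]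
        unfolding affine_invariant_values_def by blast
      ultimately show "\<exists>y\<in>affine_invariant_values K. dist y x < e"
        by (auto simp: dist_norm)
    qed
    then show "x \<in> affine_invariant_values K"
      using affine_closed[OF affine_affine_invariant_values[OF assms]] by simp
  qed
qed

end
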